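(* Let $O\subset\mathbb{R}^n$ be an open set and let $f\colon O\to\mathbb{R}$ be a lower-$\mathbf{C}^2$ function on $O$. For each $v\in\mathbb{R}^n$ let $f_v(x)=f(x)-\langle v,x\rangle$. Then for all $v$ in a subset of $\mathbb{R}^n$ of full Lebesgue measure (i.e. for all $v$ outside a Lebesgue null set), every critical point $x$ of $f_v$ (that is, every $x$ with $0\in\partial f_v(x)$) is nondegenerate, that is, satisfies $0\in\operatorname{ri}\partial f_v(x)$.
   Context: A function $f\colon O\to\mathbb{R}$ on an open set $O\subset\mathbb{R}^n$ is lower-$\mathbf{C}^2$ on $O$ if for each $\bar x\in O$ there are a neighborhood of $\bar x$ and a scalar $\rho$ such that on this neighborhood $f+\rho|\cdot|^2$ is a finite convex function, where $|\cdot|$ is the Euclidean norm. Normal cones: for $S\subset\mathbb{R}^m$ and $\bar x\in S$, the regular normal cone $\hat N_S(\bar x)$ consists of all $v$ with $\langle v,x-\bar x\rangle\le o(|x-\bar x|)$ for $x\in S$, i.e. bounded above by a term whose ratio to $|x-\bar x|$ tends to $0$ as $x\to\bar x$ in $S$, $x\ne\bar x$. The limiting normal cone $N_S(\bar x)$ consists of all $v$ for which there are sequences $x_r\in S$, $x_r\to\bar x$, and $v_r\in\hat N_S(x_r)$ with $v_r\to v$. The symbol $\partial$ denotes the limiting subdifferential: for $g\colon\mathbb{R}^n\to\mathbb{R}\cup\{-\infty,+\infty\}$ finite at $\bar x$, $\partial g(\bar x)=\{w\in\mathbb{R}^n:(w,-1)\in N_{\operatorname{epi}g}(\bar x,g(\bar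 x))\}$, where $\operatorname{epi}g=\{(x,r)\in\mathbb{R}^n\times\mathbb{R}:r\ge g(x)\}$; $\partial g(\bar x)=\emptyset$ if $g(\bar x)$ is not finite. Functions defined only on $O$ are regarded as taking the value $+\infty$ outside $O$, so $\partial f_v(x)=\emptyset$ for $x\notin O$. For lower-$\mathbf{C}^2$ functions these subdifferentials are convex sets. $\operatorname{ri}S$ denotes the relative interior of a convex set $S$ (interior relative to its affine hull). *)

theory Defs
  imports "HOL-Analysis.Analysis"
begin

(* The neighbourhood N lies in U because f is only meaningful there;
   convex_on already requires N to be convex. *)
definition lower_C2_on :: "'a::euclidean_space set \<Rightarrow> ('a \<Rightarrow> real) \<Rightarrow> bool" where
  "lower_C2_on U f \<longleftrightarrow>
     (\<forall>xbar\<in>U. \<exists>N \<rho>. open N \<and> xbar \<in> N \<and> N \<subseteq> U \<and> convex_on N (\<lambda>x. f x + \<rho> * (norm x)\<^sup>2))"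

(* \<omega> is the o(|x - xbar|) term. *)
definition regular_normal_cone :: "'a::euclidean_space set \<Rightarrow> 'a \<Rightarrow> 'a set" where
  "regular_normal_cone S xbar =
     {v. xbar \<in> S \<and>
        (\<exists>\<omega>. (\<forall>x\<in>S. v \<bullet> (x - xbar) \<le> \<omega> x) \<and>
             ((\<lambda>x. \<omega> x / norm (x - xbar)) \<longlongrightarrow> 0) (at xbar within S))}"

definition limiting_normal_cone :: "'a::euclidean_space set \<Rightarrow> 'a \<Rightarrow> 'a set" where
  "limiting_normal_cone S xbar =
     {v. xbar \<in> S \<and>
        (\<exists>x w. (\<forall>r. x r \<in> S \<and> w r \<in> regular_normal_cone S (x r)) \<and>
             x \<longlonglongrightarrow> xbar \<and> w \<longlonglongrightarrow> v)}"

(* The library's epigraph is restricted to real-valued functions. *)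
definition epi :: "('a \<Rightarrow> ereal) \<Rightarrow> ('a \<times> real) set" where
  "epi g = {(x, r). g x \<le> ereal r}"

definition limiting_subdifferential :: "('a::euclidean_space \<Rightarrow> ereal) \<Rightarrow> 'a \<Rightarrow> 'a set" where
  "limiting_subdifferential g xbar =
     (if \<bar>g xbar\<bar> = \<infinity> then {}
      else {w. (w, - 1) \<in> limiting_normal_cone (epi g) (xbar, real_of_ereal (g xbar))})"

definition extend_by_infinity :: "'a set \<Rightarrow> ('a \<Rightarrow> real) \<Rightarrow> 'a \<Rightarrow> ereal" where
  "extend_by_infinity U h x = (if x \<in> U then ereal (h x) else \<infinity>)"

definition critical_point :: "('a::euclidean_space \<Rightarrow> ereal) \<Rightarrow> 'a \<Rightarrow> bool" where
  "critical_point g x \<longleftrightarrow> 0 \<in> limiting_subdifferential g x"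

definition nondegenerate_critical_point :: "('a::euclidean_space \<Rightarrow> ereal) \<Rightarrow> 'a \<Rightarrow> bool" where
  "nondegenerate_critical_point g x \<longleftrightarrow> 0 \<in> rel_interior (limiting_subdifferential g x)"

end

theory Submission
  imports Defs
begin

text \<open>
  Let \<open>h = f + \<rho>|.|\<^sup>2\<close> be convex on a small closed ball \<open>B\<close>. At an interior point \<open>x\<close> of \<open>B\<close>, the
  limiting subdifferential of \<open>f_v\<close> is the set of convex subgradients of \<open>h\<close>,
  translated by \<open>-(v + 2\<rho>x)\<close>. With \<open>z = v + (2\<rho> + 1)x\<close>, criticality of \<open>x\<close> says that \<open>x\<close> is the
  proximal point \<open>P z\<close> of \<open>z\<close> for \<open>h\<close> on \<open>B\<close>, and degeneracy says that \<open>z\<close> lies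
  on the relative boundary of the fibre of \<open>P\<close> through \<open>z\<close>, a closed convex set.
  Since \<open>v = z - (2\<rho> + 1) P z\<close> is a Lipschitz function of \<open>z\<close>, the theorem follows, one ball at a
  time, from the fact that the relative boundaries of the fibres of \<open>P\<close> form a null set
  (\<open>negligible_relative_boundaries_of_fibres\<close>). This is a form of Larman's theorem on the
  faces of a convex function: \<open>P\<close> is the gradient of a convex function \<open>\<phi>\<close>, and its fibres are
  the maximal convex sets on which \<open>\<phi>\<close> is affine.

  Disjointness and convexity of the fibres alone would not suffice, because three-dimensional space
  contains disjoint families of segments whose end points have positive measure. What helps is that volume cannot collapse too fast along the fibres. Fix a point \<open>a\<close> and let \<open>q z\<close> be the point of the
  fibre of \<open>z\<close> closest to \<open>a\<close>. The map \<open>T\<^sub>t z = (1 - t)z + t q z\<close> moves every point inside its fibre,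
  and it shrinks volumes at most by the factor \<open>(1 - t)\<^sup>n\<close>
  (\<open>volume_contraction_bound_towards_closest_point\<close>). Heuristically, the derivative of \<open>q\<close> is
  a product of two positive semidefinite matrices, so it only adds to the determinant. Rigorously,
  \<open>q\<close> is a limit of finitely valued maps \<open>c\<close> for which \<open>z \<mapsto> (1 - t)z + t c z\<close> is injective
  and piecewise a homothety of ratio \<open>1 - t\<close>.

  Let \<open>G\<close> be the set of points \<open>z\<close> at which the ray from \<open>q z\<close> through \<open>z\<close> leaves the fibre. For
  different \<open>t\<close> the sets \<open>T\<^sub>t(G)\<close> are disjoint: the image of \<open>z\<close> determines the fibre, hence \<open>q z\<close>
  and the ray, hence \<open>z\<close> as the only point where the ray leaves the fibre, and with it \<open>t\<close>.
  A bounded part of \<open>G\<close> on which \<open>q\<close> is bounded thus has infinitely many disjoint images in one ball,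
  one for each \<open>t \<le> 1/2\<close>, of measure at least \<open>2\<^sup>-\<^sup>n\<close> times its own; so \<open>G\<close> is null. As \<open>a\<close> runs through a countable dense
  set, the sets \<open>G\<close> cover all relative boundaries: if \<open>a\<close> is close enough to a relative interior point of
  the fibre, then so is \<open>q z\<close>, which therefore is itself in the relative interior.
\<close>

section \<open>Maps with a lower bound on volume contraction\<close>

text \<open>
  The inequality is imposed on preimages, that is, on the image measure of \<open>T\<close>, and not on images: an
  image of a Borel set need not be Borel, whereas preimages pass to pointwise limits by
  Fatou's argument.
\<close>

definition volume_contraction_bound :: "real \<Rightarrow> ('a::euclidean_space \<Rightarrow> 'a) \<Rightarrow> bool" where
  "volume_contraction_bound \<kappa> T \<longleftrightarrow> T \<in> borel_measurable borel \<and>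
     (\<forall>V \<in> sets borel. ennreal \<kappa> * emeasure lborel (T -` V) \<le> emeasure lborel V)"

lemma emeasure_lborel_homothety:
  fixes A :: "'a::euclidean_space set"
  assumes "s > 0" "A \<in> sets borel"
  shows "(\<lambda>z. s *\<^sub>R z + d) ` A \<in> sets borel"
    and "emeasure lborel ((\<lambda>z. s *\<^sub>R z + d) ` A) = ennreal (s ^ DIM('a)) * emeasure lborel A"
proof -
  have eq: "(\<lambda>z. s *\<^sub>R z + d) ` A = (\<lambda>y. (1/s) *\<^sub>R (y - d)) -` A"
  proof (intro equalityI subsetI)
    fix y assume "y \<in> (\<lambda>y. (1/s) *\<^sub>R (y - d)) -` A"
    then show "y \<in> (\<lambda>z. s *\<^sub>R z + d) ` A"
      using assms(1) by (intro image_eqI[of _ _ "(1/s) *\<^sub>R (y - d)"]) auto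
  qed (use assms(1) in auto)
  have m: "(\<lambda>y. (1/s) *\<^sub>R (y - d)) \<in> borel_measurable borel" by measurable
  show *: "(\<lambda>z. s *\<^sub>R z + d) ` A \<in> sets borel"
    unfolding eq using measurable_sets[OF m assms(2)] by simp
  show "emeasure lborel ((\<lambda>z. s *\<^sub>R z + d) ` A) = ennreal (s ^ DIM('a)) * emeasure lborel A"
    using emeasure_lebesgue_affine[of s d A] * assms by (simp add: ennreal_power)
qed

text \<open>
  On each piece, where \<open>\<iota>\<close> is constant, volume is scaled exactly by \<open>s\<^sup>n\<close>, and injectivity keeps the
  images of the pieces disjoint inside the target set.
\<close>

lemma volume_contraction_bound_piecewise_homothety:
  fixes \<iota> :: "'a::euclidean_space \<Rightarrow> nat" and d :: "nat \<Rightarrow> 'a"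
  assumes "s > 0" and \<iota>[measurable]: "\<iota> \<in> borel \<rightarrow>\<^sub>M count_space UNIV"
    and inj: "inj (\<lambda>z. s *\<^sub>R z + d (\<iota> z))"
  shows "volume_contraction_bound (s ^ DIM('a)) (\<lambda>z. s *\<^sub>R z + d (\<iota> z))"
proof -
  define T where "T z = s *\<^sub>R z + d (\<iota> z)" for z
  have [measurable]: "T \<in> borel_measurable borel"
  proof -
    have "(\<lambda>z. d (\<iota> z)) \<in> borel_measurable borel"
      by (rule measurable_compose[OF \<iota>]) auto
    then show ?thesis unfolding T_def by measurable
  qed
  have "ennreal (s ^ DIM('a)) * emeasure lborel (T -` V) \<le> emeasure lborel V"
    if V[measurable]: "V \<in> sets borel" for V
  proof -
    define A where "A i = \<iota> -` {i} \<inter> T -` V" for i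
    have A: "A i \<in> sets borel" for i
    proof -
      have "\<iota> -` {i} \<in> sets borel" using measurable_sets[OF \<iota>, of "{i}"] by simp
      moreover have "T -` V \<in> sets borel"
        using measurable_sets[OF \<open>T \<in> borel_measurable borel\<close> V] by simp
      ultimately show ?thesis by (auto simp: A_def)
    qed
    have TA: "T ` A i = (\<lambda>z. s *\<^sub>R z + d i) ` A i" for i
      by (auto simp: T_def A_def)
    have TAm: "T ` A i \<in> sets borel" for i
      unfolding TA by (rule emeasure_lborel_homothety[OF \<open>s > 0\<close> A])
    have injT: "inj T" using inj by (simp add: T_def[abs_def])
    have "disjoint_family A" by (auto simp: disjoint_family_on_def A_def)
    moreover from this have "disjoint_family (\<lambda>i. T ` A i)"
      unfolding disjoint_family_on_def
      by (metis UNIV_I image_Int[OF injT] image_empty)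
    moreover have "T -` V = (\<Union>i. A i)" by (auto simp: A_def)
    ultimately have "ennreal (s ^ DIM('a)) * emeasure lborel (T -` V)
        = ennreal (s ^ DIM('a)) * (\<Sum>i. emeasure lborel (A i))"
      using A by (subst suminf_emeasure) auto
    also have "\<dots> = (\<Sum>i. ennreal (s ^ DIM('a)) * emeasure lborel (A i))"
      by simp
    also have "\<dots> = (\<Sum>i. emeasure lborel (T ` A i))"
      unfolding TA by (simp only: emeasure_lborel_homothety(2)[OF \<open>s > 0\<close> A])
    also have "\<dots> = emeasure lborel (\<Union>i. T ` A i)"
      using TAm \<open>disjoint_family (\<lambda>i. T ` A i)\<close> by (subst suminf_emeasure) auto
    also have "\<dots> \<le> emeasure lborel V"
      by (intro emeasure_mono) (auto simp: A_def)
    finally show ?thesis .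
  qed
  then show ?thesis
    unfolding volume_contraction_bound_def T_def[symmetric] by auto
qed

text \<open>
  If \<open>T z\<close> lies in an open set, then so does \<open>T' k z\<close> for all large \<open>k\<close>; this gives the bound for open sets,
  and outer regularity of Lebesgue measure extends it to Borel sets.
\<close>

lemma volume_contraction_bound_limit:
  fixes T :: "'a::euclidean_space \<Rightarrow> 'a"
  assumes bnd: "\<And>k. volume_contraction_bound \<kappa> (T' k)"
    and lim: "\<And>z. (\<lambda>k. T' k z) \<longlonglongrightarrow> T z"
  shows "volume_contraction_bound \<kappa> T"
proof -
  have T'm[measurable]: "T' k \<in> borel_measurable borel" for k
    using bnd by (auto simp: volume_contraction_bound_def)
  have Tm: "T \<in> borel_measurable borel"
    by (rule borel_measurable_LIMSEQ_metric[OF T'm lim])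
  have pre: "T' k -` V \<in> sets borel" if "V \<in> sets borel" for k V
    using measurable_sets[OF T'm that] by simp
  have op: "ennreal \<kappa> * emeasure lborel (T -` V) \<le> emeasure lborel V" if "open V" for V
  proof -
    define A where "A m = (\<Inter>k\<in>{m..}. T' k -` V)" for m
    have A: "A m \<in> sets borel" for m
      unfolding A_def using pre[of V] that by (intro sets.countable_INT) auto
    have "T -` V \<subseteq> (\<Union>m. A m)"
    proof
      fix z assume "z \<in> T -` V"
      then have "\<forall>\<^sub>F k in sequentially. T' k z \<in> V"
        using lim[of z] that topological_tendstoD by (metis vimageD)
      then show "z \<in> (\<Union>m. A m)"
        by (auto simp: eventually_sequentially A_def)
    qed
    then have "ennreal \<kappa> * emeasure lborel (T -` V) \<le> ennreal \<kappa> * emeasure lborel (\<Union>m. A m)"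
      using A by (intro mult_left_mono emeasure_mono) auto
    also have "\<dots> = ennreal \<kappa> * (SUP m. emeasure lborel (A m))"
      using A by (subst SUP_emeasure_incseq) (auto simp: incseq_def A_def)
    also have "\<dots> = (SUP m. ennreal \<kappa> * emeasure lborel (A m))"
      by (simp add: SUP_mult_left_ennreal)
    also have "\<dots> \<le> emeasure lborel V"
    proof (rule SUP_least)
      fix m
      have "ennreal \<kappa> * emeasure lborel (A m) \<le> ennreal \<kappa> * emeasure lborel (T' m -` V)"
        using pre[of V] that by (intro mult_left_mono emeasure_mono) (auto simp: A_def)
      also have "\<dots> \<le> emeasure lborel V"
        using bnd[of m] that by (auto simp: volume_contraction_bound_def)
      finally show "ennreal \<kappa> * emeasure lborel (A m) \<le> emeasure lborel V" .
    qed
    finally show ?thesis .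
  qed
  have "ennreal \<kappa> * emeasure lborel (T -` V) \<le> emeasure lborel V" if V: "V \<in> sets borel" for V
  proof (rule ennreal_le_epsilon)
    fix e :: real assume "0 < e"
    then obtain W where W: "open W" "V \<subseteq> W" "emeasure lborel (W - V) < e"
      using outer_regular_lborel[OF V, of e] by auto
    have "T -` W \<in> sets lborel" using measurable_sets[OF Tm, of W] W by simp
    then have "ennreal \<kappa> * emeasure lborel (T -` V) \<le> ennreal \<kappa> * emeasure lborel (T -` W)"
      using W by (intro mult_left_mono emeasure_mono) auto
    also have "\<dots> \<le> emeasure lborel W" by (rule op[OF W(1)])
    also have "\<dots> = emeasure lborel (V \<union> (W - V))"
      using W(2) by (simp add: Un_absorb1)
    also have "\<dots> \<le> emeasure lborel V + emeasure lborel (W - V)"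
      using V W by (intro emeasure_subadditive) auto
    also have "\<dots> \<le> emeasure lborel V + e" using W(3) by (intro add_left_mono) auto
    finally show "ennreal \<kappa> * emeasure lborel (T -` V) \<le> emeasure lborel V + ennreal e" .
  qed
  with Tm show ?thesis by (auto simp: volume_contraction_bound_def)
qed

section \<open>Gradients of convex functions and their fibres\<close>

text \<open>
  The two axioms say that \<open>\<phi>\<close> is convex with gradient \<open>P\<close> and that \<open>P\<close> is Lipschitz with constant
  one; firm nonexpansiveness is the form in which the Lipschitz condition is used.
\<close>

locale convex_gradient =
  fixes P :: "'a::euclidean_space \<Rightarrow> 'a" and \<phi> :: "'a \<Rightarrow> real"
  assumes firmly_nonexpansive: "(norm (P y - P z))\<^sup>2 \<le> (y - z) \<bullet> (P y - P z)"
    and subgradient: "\<phi> z + P z \<bullet> (y - z) \<le> \<phi> y"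
begin

definition fibre :: "'a \<Rightarrow> 'a set" where
  "fibre z = {y. P y = P z}"

lemma fibre_self: "z \<in> fibre z"
  by (simp add: fibre_def)

lemma nonexpansive: "norm (P y - P z) \<le> norm (y - z)"
proof -
  have "norm (P y - P z) * norm (P y - P z) \<le> norm (y - z) * norm (P y - P z)"
    using firmly_nonexpansive[of y z] norm_cauchy_schwarz[of "y - z" "P y - P z"]
    by (simp add: power2_eq_square)
  then show ?thesis
    by (cases "norm (P y - P z) = 0") auto
qed

lemma continuous_P: "continuous_on UNIV P"
  unfolding continuous_on_iff dist_norm using nonexpansive le_less_trans by blast

lemma borel_measurable_P[measurable]: "P \<in> borel_measurable borel"
  by (rule borel_measurable_continuous_onI[OF continuous_P])

lemma closed_fibre: "closed (fibre z)"
  unfolding fibre_def using closed_Collect_eq[OF continuous_P, of "\<lambda>_. P z"] by simp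

lemma convex_fibre: "convex (fibre z)"
proof (rule convexI)
  fix y\<^sub>1 y\<^sub>2 :: 'a and u v :: real
  assume y: "y\<^sub>1 \<in> fibre z" "y\<^sub>2 \<in> fibre z" and uv: "0 \<le> u" "0 \<le> v" "u + v = 1"
  define y where "y = u *\<^sub>R y\<^sub>1 + v *\<^sub>R y\<^sub>2"
  have "u * (norm (P y - P z))\<^sup>2 + v * (norm (P y - P z))\<^sup>2
      \<le> u * ((y - y\<^sub>1) \<bullet> (P y - P z)) + v * ((y - y\<^sub>2) \<bullet> (P y - P z))"
    using firmly_nonexpansive[of y y\<^sub>1] firmly_nonexpansive[of y y\<^sub>2] y uv
    by (intro add_mono mult_left_mono) (auto simp: fibre_def)
  also have "\<dots> = ((u + v) *\<^sub>R y - (u *\<^sub>R y\<^sub>1 + v *\<^sub>R y\<^sub>2)) \<bullet> (P y - P z)"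
    by (simp add: algebra_simps)
  also have "\<dots> = 0" using uv by (simp add: y_def)
  finally have "(u + v) * (norm (P y - P z))\<^sup>2 \<le> 0" by (simp add: algebra_simps)
  then show "u *\<^sub>R y\<^sub>1 + v *\<^sub>R y\<^sub>2 \<in> fibre z"
    using uv by (simp add: fibre_def y_def)
qed

text \<open>
  The Bregman distance from \<open>z\<close> to \<open>y\<close>. It vanishes precisely on the fibre of \<open>z\<close>, and the next
  lemmas make both directions quantitative: it is at most quadratic in the distance to the fibre, and it controls
  the change of \<open>P\<close>.
\<close>

definition gap :: "'a \<Rightarrow> 'a \<Rightarrow> real" where
  "gap z y = \<phi> y - \<phi> z - P z \<bullet> (y - z)"

lemma gap_nonneg: "0 \<le> gap z y"
  using subgradient[of z y] by (simp add: gap_def)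

lemma gap_fibre_le:
  assumes "x \<in> fibre z"
  shows "gap z y \<le> (norm (y - x))\<^sup>2"
proof -
  have "\<phi> z \<ge> \<phi> x + P x \<bullet> (z - x)" by (rule subgradient)
  then have "gap z y \<le> \<phi> y - \<phi> x - P x \<bullet> (y - x)"
    using assms by (simp add: gap_def fibre_def inner_diff_right)
  also have "\<dots> \<le> (P y - P x) \<bullet> (y - x)"
    using subgradient[of y x] by (simp add: inner_diff_right inner_diff_left)
  also have "\<dots> \<le> norm (P y - P x) * norm (y - x)"
    by (rule norm_cauchy_schwarz)
  also have "\<dots> \<le> norm (y - x) * norm (y - x)"
    by (intro mult_right_mono nonexpansive) auto
  finally show ?thesis by (simp add: power2_eq_square)
qed

text \<open>
  Comparing \<open>y\<close> with a gradient step \<open>y' = y - u/2\<close>, where \<open>u = P y - P z\<close>, shows that a point where \<open>P\<close>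
  differs from \<open>P z\<close> still has room for descent.
\<close>

lemma gap_ge: "(norm (P y - P z))\<^sup>2 \<le> 4 * gap z y"
proof -
  define u where "u = P y - P z"
  define y' where "y' = y - (1/2) *\<^sub>R u"
  have "gap z y \<ge> (P y' - P z) \<bullet> ((1/2) *\<^sub>R u)"
  proof -
    have "\<phi> y \<ge> \<phi> y' + P y' \<bullet> (y - y')" "\<phi> y' \<ge> \<phi> z + P z \<bullet> (y' - z)"
      by (rule subgradient)+
    then show ?thesis
      by (simp add: gap_def y'_def inner_diff_right inner_diff_left)
  qed
  moreover have "(P y - P y') \<bullet> u \<le> (1/2) * (norm u)\<^sup>2"
  proof -
    have "(P y - P y') \<bullet> u \<le> norm (P y - P y') * norm u"
      by (rule norm_cauchy_schwarz)
    also have "\<dots> \<le> norm (y - y') * norm u"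
      by (intro mult_right_mono nonexpansive) auto
    finally show ?thesis by (simp add: y'_def power2_eq_square)
  qed
  moreover have "(P y' - P z) \<bullet> u = (norm u)\<^sup>2 - (P y - P y') \<bullet> u"
    by (simp add: u_def power2_norm_eq_inner inner_diff_left)
  ultimately show ?thesis by (simp add: u_def[symmetric])
qed

end

section \<open>Volume estimate for shrinking along the fibres\<close>

text \<open>
  Choosing the least index breaks ties by a rule that depends on \<open>p\<close> alone. Equal values of
  \<open>p\<close> thus select equal points, which is what makes the maps below injective everywhere.
\<close>

definition least_argmin :: "'a::euclidean_space list \<Rightarrow> ('a \<Rightarrow> real) \<Rightarrow> 'a \<Rightarrow> nat" where
  "least_argmin xs h p =
     (LEAST i. i < length xs \<and> (\<forall>d\<in>set xs. h (xs ! i) - p \<bullet> xs ! i \<le> h d - p \<bullet> d))"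

lemma least_argmin:
  assumes "xs \<noteq> []"
  shows "least_argmin xs h p < length xs"
    and "d \<in> set xs \<Longrightarrow>
           h (xs ! least_argmin xs h p) - p \<bullet> xs ! least_argmin xs h p \<le> h d - p \<bullet> d"
proof -
  let ?Q = "\<lambda>i. i < length xs \<and> (\<forall>d\<in>set xs. h (xs ! i) - p \<bullet> xs ! i \<le> h d - p \<bullet> d)"
  have "\<exists>y\<in>set xs. \<forall>d\<in>set xs. h y - p \<bullet> y \<le> h d - p \<bullet> d"
    using ex_is_arg_min_if_finite[of "set xs" "\<lambda>y. h y - p \<bullet> y"] assms
    by (auto simp: is_arg_min_linorder)
  then have "\<exists>i. ?Q i" by (metis in_set_conv_nth)
  then have "?Q (least_argmin xs h p)"
    unfolding least_argmin_def by (rule LeastI_ex)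
  then show "least_argmin xs h p < length xs"
    and "d \<in> set xs \<Longrightarrow>
           h (xs ! least_argmin xs h p) - p \<bullet> xs ! least_argmin xs h p \<le> h d - p \<bullet> d"
    by auto
qed

lemma finite_net_cball:
  fixes e :: real
  assumes "e > 0" "r \<ge> 0"
  shows "\<exists>xs :: 'a::euclidean_space list. xs \<noteq> [] \<and> (\<forall>y\<in>cball 0 r. \<exists>d\<in>set xs. dist d y < e)"
proof -
  obtain D :: "'a set" where D: "finite D" "cball 0 r \<subseteq> (\<Union>x\<in>D. ball x e)"
    using seq_compact_imp_totally_bounded[of "cball (0::'a) r"] assms
    by (meson compact_cball compact_imp_seq_compact)
  obtain xs where xs: "set xs = D" using finite_list[OF D(1)] by auto
  have "(0::'a) \<in> cball 0 r" using assms by simp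
  with D xs have "xs \<noteq> []" by fastforce
  moreover have "\<exists>d\<in>set xs. dist d y < e" if "y \<in> cball 0 r" for y
    using subsetD[OF D(2) that] xs by auto
  ultimately show ?thesis by blast
qed

context convex_gradient begin

text \<open>
  Whatever \<open>h\<close> is, the minimizer of \<open>h d - p \<bullet> d\<close> over a finite set depends monotonically on \<open>p\<close>.
  If two points \<open>z\<close> and \<open>z'\<close> had the same image, their difference would be a nonpositive multiple of the
  difference of the selected points, so that monotonicity of the selection and of \<open>P\<close> would pull in opposite directions.
  Firm nonexpansiveness then forces \<open>P z = P z'\<close>, and with it \<open>z = z'\<close>.
\<close>

lemma volume_contraction_bound_least_argmin:
  assumes t: "0 \<le> t" "t < 1" and "xs \<noteq> []"
  shows "volume_contraction_bound ((1 - t) ^ DIM('a))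
           (\<lambda>z. (1 - t) *\<^sub>R z + t *\<^sub>R xs ! least_argmin xs h (P z))"
proof (rule volume_contraction_bound_piecewise_homothety[where d = "\<lambda>i. t *\<^sub>R xs ! i"])
  show "(\<lambda>z. least_argmin xs h (P z)) \<in> borel \<rightarrow>\<^sub>M count_space UNIV"
    unfolding least_argmin_def by measurable
  show "inj (\<lambda>z. (1 - t) *\<^sub>R z + t *\<^sub>R xs ! least_argmin xs h (P z))"
  proof (rule injI)
    fix z z'
    let ?c = "xs ! least_argmin xs h (P z)" and ?c' = "xs ! least_argmin xs h (P z')"
    assume eq: "(1 - t) *\<^sub>R z + t *\<^sub>R ?c = (1 - t) *\<^sub>R z' + t *\<^sub>R ?c'"
    have "h ?c - P z \<bullet> ?c \<le> h ?c' - P z \<bullet> ?c'" "h ?c' - P z' \<bullet> ?c' \<le> h ?c - P z' \<bullet> ?c"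
      using least_argmin[OF \<open>xs \<noteq> []\<close>] by auto
    then have "0 \<le> (?c - ?c') \<bullet> (P z - P z')"
      by (simp add: inner_diff_left inner_diff_right inner_commute)
    then have "0 \<le> t * ((?c - ?c') \<bullet> (P z - P z'))" using t by simp
    moreover have "(1 - t) * (norm (P z - P z'))\<^sup>2 \<le> (1 - t) * ((z - z') \<bullet> (P z - P z'))"
      using t firmly_nonexpansive by (intro mult_left_mono) auto
    moreover have "(1 - t) * ((z - z') \<bullet> (P z - P z')) + t * ((?c - ?c') \<bullet> (P z - P z')) = 0"
    proof -
      have "(1 - t) *\<^sub>R (z - z') + t *\<^sub>R (?c - ?c') = 0"
        using eq by (simp add: algebra_simps)
      then have "((1 - t) *\<^sub>R (z - z') + t *\<^sub>R (?c - ?c')) \<bullet> (P z - P z') = 0" by simp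
      then show ?thesis by (simp only: inner_add_left inner_scaleR_left)
    qed
    ultimately have "(1 - t) * (norm (P z - P z'))\<^sup>2 \<le> 0" by linarith
    then have "P z = P z'" using t by (simp add: mult_le_0_iff)
    with eq t show "z = z'" by simp
  qed
qed (use t in auto)

text \<open>
  A Tikhonov regularization argument. The penalty with weight \<open>\<epsilon> = 1/(k+1)\<close> selects, among the minimizers
  of the Bregman distance, the one closest to \<open>a\<close>. Restricting the minimization to a net of mesh
  \<open>\<epsilon>\<close> costs only \<open>\<epsilon>\<^sup>2\<close> in Bregman distance, because that distance is quadratic near the fibre;
  this is negligible against the weight of the penalty.
\<close>

lemma regularized_minimizers_tendsto_closest_point:
  assumes net: "\<And>k y. y \<in> cball 0 (real k) \<Longrightarrow> \<exists>d\<in>D k. dist d y < 1 / Suc k"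
    and opt: "\<And>k d. d \<in> D k \<Longrightarrow>
      gap z (c k) + (1 / Suc k) * (norm (c k - a))\<^sup>2 \<le> gap z d + (1 / Suc k) * (norm (d - a))\<^sup>2"
  shows "c \<longlonglongrightarrow> closest_point (fibre z) a"
proof (rule ccontr)
  define \<pi> where "\<pi> = closest_point (fibre z) a"
  have \<pi>: "\<pi> \<in> fibre z"
    unfolding \<pi>_def by (rule closest_point_in_set[OF closed_fibre]) (auto simp: fibre_def)
  define M where "M = norm (\<pi> - a)"
  define \<epsilon> where "\<epsilon> k = 1 / real (Suc k)" for k
  have \<epsilon>0: "\<epsilon> \<longlonglongrightarrow> 0" unfolding \<epsilon>_def by (rule lim_1_over_real_power[of 1, simplified, THEN LIMSEQ_Suc])
  have \<epsilon>pos: "\<epsilon> k > 0" for k by (simp add: \<epsilon>_def)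
  \<comment> \<open>Compare the minimizer with a net point close to the closest point \<open>\<pi>\<close>.\<close>
  have main: "\<forall>\<^sub>F k in sequentially. gap z (c k) + \<epsilon> k * (norm (c k - a))\<^sup>2 \<le> \<epsilon> k * (\<epsilon> k + (M + \<epsilon> k)\<^sup>2)"
  proof -
    obtain N :: nat where N: "norm \<pi> \<le> N" using real_arch_simple by blast
    have "gap z (c k) + \<epsilon> k * (norm (c k - a))\<^sup>2 \<le> \<epsilon> k * (\<epsilon> k + (M + \<epsilon> k)\<^sup>2)" if "k \<ge> N" for k
    proof -
      have "norm \<pi> \<le> k" using N that by linarith
      then obtain d where d: "d \<in> D k" "dist d \<pi> < \<epsilon> k"
        using net[of \<pi> k] by (auto simp: \<epsilon>_def)
      have "norm (d - a) \<le> norm (\<pi> - a) + norm (d - \<pi>)"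
        by (metis add.commute diff_add_cancel diff_add_eq norm_triangle_ineq add_diff_eq)
      then have "norm (d - a) \<le> M + \<epsilon> k" using d by (simp add: M_def dist_norm)
      then have "(norm (d - a))\<^sup>2 \<le> (M + \<epsilon> k)\<^sup>2" by (intro power_mono) auto
      moreover have "gap z d \<le> (\<epsilon> k)\<^sup>2"
      proof -
        have "gap z d \<le> (norm (d - \<pi>))\<^sup>2" by (rule gap_fibre_le[OF \<pi>])
        also have "\<dots> \<le> (\<epsilon> k)\<^sup>2" using d by (intro power_mono) (auto simp: dist_norm)
        finally show ?thesis .
      qed
      ultimately have "gap z d + \<epsilon> k * (norm (d - a))\<^sup>2 \<le> (\<epsilon> k)\<^sup>2 + \<epsilon> k * (M + \<epsilon> k)\<^sup>2"
        using \<epsilon>pos[of k] by (intro add_mono mult_left_mono) auto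
      moreover have "\<epsilon> k * (\<epsilon> k + (M + \<epsilon> k)\<^sup>2) = (\<epsilon> k)\<^sup>2 + \<epsilon> k * (M + \<epsilon> k)\<^sup>2"
        by (simp add: distrib_left power2_eq_square)
      ultimately show ?thesis using opt[OF d(1), folded \<epsilon>_def] by linarith
    qed
    then show ?thesis by (auto simp: eventually_sequentially)
  qed
  have near: "\<forall>\<^sub>F k in sequentially. (norm (c k - a))\<^sup>2 \<le> \<epsilon> k + (M + \<epsilon> k)\<^sup>2"
    using main
  proof eventually_elim
    case (elim k)
    then have "\<epsilon> k * (norm (c k - a))\<^sup>2 \<le> \<epsilon> k * (\<epsilon> k + (M + \<epsilon> k)\<^sup>2)"
      using gap_nonneg[of z "c k"] by linarith
    then show ?case using \<epsilon>pos[of k] by (simp add: mult_le_cancel_left_pos)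
  qed
  have small: "\<forall>\<^sub>F k in sequentially. (norm (P (c k) - P z))\<^sup>2 \<le> 4 * (\<epsilon> k * (\<epsilon> k + (M + \<epsilon> k)\<^sup>2))"
    using main
  proof eventually_elim
    case (elim k)
    have "\<epsilon> k * (norm (c k - a))\<^sup>2 \<ge> 0" using \<epsilon>pos[of k] by (auto intro: less_imp_le)
    with elim gap_ge[of "c k" z] show ?case by linarith
  qed
  have "(\<lambda>k. 4 * (\<epsilon> k * (\<epsilon> k + (M + \<epsilon> k)\<^sup>2))) \<longlonglongrightarrow> 4 * (0 * (0 + (M + 0)\<^sup>2))"
    by (intro tendsto_intros \<epsilon>0)
  then have P0: "(\<lambda>k. (norm (P (c k) - P z))\<^sup>2) \<longlonglongrightarrow> 0"
    by (intro tendsto_sandwich[OF _ small tendsto_const]) auto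
  have R: "(\<lambda>k. \<epsilon> k + (M + \<epsilon> k)\<^sup>2) \<longlonglongrightarrow> 0 + (M + 0)\<^sup>2"
    by (intro tendsto_intros \<epsilon>0)
  assume "\<not> c \<longlonglongrightarrow> closest_point (fibre z) a"
  then obtain e where e: "e > 0" "\<forall>N. \<exists>n\<ge>N. e \<le> dist (c n) \<pi>"
    by (auto simp: lim_sequentially \<pi>_def not_less)
  \<comment> \<open>A subsequence that stays away from \<open>\<pi>\<close> has a cluster point in the fibre that is as close to \<open>a\<close> as \<open>\<pi>\<close>.\<close>
  then have inf: "infinite {n. e \<le> dist (c n) \<pi>}"
    by (auto simp: infinite_nat_iff_unbounded_le)
  define r where "r = enumerate {n. e \<le> dist (c n) \<pi>}"
  have r: "strict_mono r" using inf by (simp add: r_def strict_mono_enumerate)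
  have re: "e \<le> dist (c (r k)) \<pi>" for k using enumerate_in_set[OF inf] by (simp add: r_def)
  have "bounded (range c)"
  proof -
    define B where "B = M\<^sup>2 + 1"
    have B: "\<forall>\<^sub>F k in sequentially. \<epsilon> k + (M + \<epsilon> k)\<^sup>2 \<le> B"
      using order_tendstoD(2)[OF R, of B] by (auto elim!: eventually_mono simp: B_def)
    have "\<forall>\<^sub>F k in sequentially. dist (c k) a \<le> sqrt B"
      using near B by eventually_elim (auto simp: dist_norm real_le_rsqrt)
    moreover have "sqrt B > 0" by (simp add: B_def add_nonneg_pos)
    ultimately have "Bfun c sequentially" unfolding Bfun_metric_def by blast
    then show ?thesis by (simp add: Bseq_eq_bounded)
  qed
  then have "bounded (range (c \<circ> r))" by (rule bounded_subset) auto
  then obtain l s where s: "strict_mono s" "((c \<circ> r) \<circ> s) \<longlonglongrightarrow> l"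
    using bounded_imp_convergent_subsequence[of "c \<circ> r"] by auto
  define q where "q = r \<circ> s"
  have q: "strict_mono q" "(\<lambda>k. c (q k)) \<longlonglongrightarrow> l"
    using s r by (auto simp: q_def o_def strict_mono_def)
  have sub: "(\<lambda>k. X (q k)) \<longlonglongrightarrow> x" if "X \<longlonglongrightarrow> x" for X :: "nat \<Rightarrow> real" and x
    using LIMSEQ_subseq_LIMSEQ[OF that q(1)] by (simp add: o_def)
  have "(\<lambda>k. (norm (P (c (q k)) - P z))\<^sup>2) \<longlonglongrightarrow> (norm (P l - P z))\<^sup>2"
    by (intro tendsto_intros continuous_on_tendsto_compose[OF continuous_P q(2)]) auto
  then have "(norm (P l - P z))\<^sup>2 = 0"
    using sub[OF P0] LIMSEQ_unique by blast
  then have l: "l \<in> fibre z" by (simp add: fibre_def)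
  have "(norm (l - a))\<^sup>2 \<le> M\<^sup>2"
  proof (rule tendsto_le)
    show "(\<lambda>k. \<epsilon> (q k) + (M + \<epsilon> (q k))\<^sup>2) \<longlonglongrightarrow> M\<^sup>2" using sub[OF R] by simp
    show "(\<lambda>k. (norm (c (q k) - a))\<^sup>2) \<longlonglongrightarrow> (norm (l - a))\<^sup>2"
      by (intro tendsto_intros q(2))
    show "\<forall>\<^sub>F k in sequentially. (norm (c (q k) - a))\<^sup>2 \<le> \<epsilon> (q k) + (M + \<epsilon> (q k))\<^sup>2"
      by (rule eventually_subseq[OF q(1) near])
  qed auto
  then have "norm (l - a) \<le> norm (\<pi> - a)" unfolding M_def by (rule power2_le_imp_le) simp
  then have "dist a l \<le> dist a \<pi>" by (simp add: dist_norm norm_minus_commute)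
  then have "l = \<pi>"
    unfolding \<pi>_def
    by (intro closest_point_unique[OF convex_fibre closed_fibre l] ballI)
       (rule order_trans[OF _ closest_point_le[OF closed_fibre]])
  moreover have "e \<le> dist l \<pi>"
    using re by (intro tendsto_lowerbound[OF tendsto_dist[OF q(2) tendsto_const]]) (auto simp: q_def)
  ultimately show False using e by simp
qed

lemma closest_point_fibre_limit:
  obtains xs :: "nat \<Rightarrow> 'a list" and h :: "nat \<Rightarrow> 'a \<Rightarrow> real"
  where "\<And>k. xs k \<noteq> []"
    and "\<And>z. (\<lambda>k. xs k ! least_argmin (xs k) (h k) (P z)) \<longlonglongrightarrow> closest_point (fibre z) a"
proof -
  have "\<exists>xs :: 'a list. xs \<noteq> [] \<and> (\<forall>y\<in>cball 0 (real k). \<exists>d\<in>set xs. dist d y < 1 / Suc k)" for k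
    by (rule finite_net_cball) auto
  then obtain xs :: "nat \<Rightarrow> 'a list" where
    xs: "\<And>k. xs k \<noteq> []" "\<And>k y. y \<in> cball 0 (real k) \<Longrightarrow> \<exists>d\<in>set (xs k). dist d y < 1 / Suc k"
    by metis
  define h where "h k y = \<phi> y + (1 / Suc k) * (norm (y - a))\<^sup>2" for k y
  have "(\<lambda>k. xs k ! least_argmin (xs k) (h k) (P z)) \<longlonglongrightarrow> closest_point (fibre z) a" for z
  proof (rule regularized_minimizers_tendsto_closest_point[where D = "\<lambda>k. set (xs k)", OF xs(2)])
    fix k d assume "d \<in> set (xs k)"
    then show "gap z (xs k ! least_argmin (xs k) (h k) (P z))
          + (1 / Suc k) * (norm (xs k ! least_argmin (xs k) (h k) (P z) - a))\<^sup>2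
        \<le> gap z d + (1 / Suc k) * (norm (d - a))\<^sup>2"
      using least_argmin(2)[OF xs(1), of d k "h k" "P z"]
      by (simp add: gap_def h_def inner_diff_right)
  qed
  with xs(1) show ?thesis by (rule that)
qed

lemma volume_contraction_bound_towards_closest_point:
  assumes t: "0 \<le> t" "t < 1"
  shows "volume_contraction_bound ((1 - t) ^ DIM('a))
           (\<lambda>z. (1 - t) *\<^sub>R z + t *\<^sub>R closest_point (fibre z) a)"
proof -
  obtain xs h where xs: "\<And>k. xs k \<noteq> []"
    and lim: "\<And>z. (\<lambda>k. xs k ! least_argmin (xs k) (h k) (P z)) \<longlonglongrightarrow> closest_point (fibre z) a"
    using closest_point_fibre_limit[of a] by auto
  show ?thesis
  proof (rule volume_contraction_bound_limit)
    show "volume_contraction_bound ((1 - t) ^ DIM('a))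
            (\<lambda>z. (1 - t) *\<^sub>R z + t *\<^sub>R xs k ! least_argmin (xs k) (h k) (P z))" for k
      by (rule volume_contraction_bound_least_argmin[OF t xs])
    show "(\<lambda>k. (1 - t) *\<^sub>R z + t *\<^sub>R xs k ! least_argmin (xs k) (h k) (P z))
            \<longlonglongrightarrow> (1 - t) *\<^sub>R z + t *\<^sub>R closest_point (fibre z) a" for z
      by (intro tendsto_intros lim)
  qed
qed

lemma borel_measurable_closest_point_fibre:
  "(\<lambda>z. closest_point (fibre z) a) \<in> borel_measurable borel"
proof -
  obtain xs h where "\<And>k. xs k \<noteq> []" and lim:
    "\<And>z. (\<lambda>k. xs k ! least_argmin (xs k) (h k) (P z)) \<longlonglongrightarrow> closest_point (fibre z) a"
    using closest_point_fibre_limit[of a] by auto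
  show ?thesis
  proof (rule borel_measurable_LIMSEQ_metric[OF _ lim])
    fix k
    have "(\<lambda>z. least_argmin (xs k) (h k) (P z)) \<in> borel \<rightarrow>\<^sub>M count_space UNIV"
      unfolding least_argmin_def by measurable
    then show "(\<lambda>z. xs k ! least_argmin (xs k) (h k) (P z)) \<in> borel_measurable borel"
      by (rule measurable_compose) auto
  qed
qed

section \<open>The relative boundaries of the fibres form a null set\<close>

definition fibre_exit_points :: "'a \<Rightarrow> 'a set" where
  "fibre_exit_points a = {z. closest_point (fibre z) a \<noteq> z \<and>
     (\<forall>s>0. z + s *\<^sub>R (z - closest_point (fibre z) a) \<notin> fibre z)}"


text \<open>
  By convexity of the fibre it suffices to test the steps \<open>s = 1/(m+1)\<close>, which turns the definition into a
  countable intersection.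
\<close>

lemma fibre_exit_points_borel: "fibre_exit_points a \<in> sets borel"
proof -
  define q where "q z = closest_point (fibre z) a" for z
  have [measurable]: "q \<in> borel_measurable borel"
    unfolding q_def[abs_def] by (rule borel_measurable_closest_point_fibre)
  have countable_exit: "(\<forall>s>0. z + s *\<^sub>R (z - q z) \<notin> fibre z) \<longleftrightarrow>
      (\<forall>m. P (z + (1 / Suc m) *\<^sub>R (z - q z)) \<noteq> P z)" for z
  proof (intro iffI allI impI)
    fix m :: nat assume "\<forall>s>0. z + s *\<^sub>R (z - q z) \<notin> fibre z"
    then have "z + (1 / Suc m) *\<^sub>R (z - q z) \<notin> fibre z"
      by (elim allE[of _ "1 / Suc m"]) simp
    then show "P (z + (1 / Suc m) *\<^sub>R (z - q z)) \<noteq> P z" unfolding fibre_def by simp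
  next
    fix s :: real
    assume m: "\<forall>m. P (z + (1 / Suc m) *\<^sub>R (z - q z)) \<noteq> P z" and s: "s > 0"
    show "z + s *\<^sub>R (z - q z) \<notin> fibre z"
    proof
      assume in_f: "z + s *\<^sub>R (z - q z) \<in> fibre z"
      obtain n where n: "1 / real (Suc n) < s"
        using reals_Archimedean[OF s] unfolding inverse_eq_divide by blast
      define u where "u = (1 / real (Suc n)) / s"
      have u: "0 \<le> u" "u * s = 1 / real (Suc n)" using s by (simp_all add: u_def)
      have u1: "u \<le> 1" using n s unfolding u_def by (subst pos_divide_le_eq) auto
      have "(1 - u) *\<^sub>R z + u *\<^sub>R (z + s *\<^sub>R (z - q z)) \<in> fibre z"
        using u u1 by (intro convexD[OF convex_fibre fibre_self in_f]) simp_all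
      also have "(1 - u) *\<^sub>R z + u *\<^sub>R (z + s *\<^sub>R (z - q z)) = z + (u * s) *\<^sub>R (z - q z)"
        by (simp add: algebra_simps)
      finally show False using m u(2) unfolding fibre_def by simp
    qed
  qed
  have "Measurable.pred borel (\<lambda>z. q z \<noteq> z \<and> (\<forall>m. P (z + (1 / Suc m) *\<^sub>R (z - q z)) \<noteq> P z))"
    by measurable
  then show ?thesis
    unfolding fibre_exit_points_def q_def[symmetric] countable_exit by (simp add: pred_def)
qed

text \<open>
  The images of a bounded part \<open>G r\<close> under the shrinking maps are written as \<open>V r t\<close> by means of the explicit
  inverse \<open>\<sigma> t\<close>. The inverse exists because a point and its image share their fibre and hence the centre
  \<open>q\<close> of the shrinking; it also shows that the images are Borel. Infinitely many disjoint such sets of measure at least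
  \<open>2\<^sup>-\<^sup>n |G r|\<close> fit in a ball only if \<open>G r\<close> is null.
\<close>

lemma negligible_fibre_exit_points: "negligible (fibre_exit_points a)"
proof -
  define q where "q z = closest_point (fibre z) a" for z
  have [measurable]: "q \<in> borel_measurable borel"
    unfolding q_def[abs_def] by (rule borel_measurable_closest_point_fibre)
  define G where "G r = fibre_exit_points a \<inter> {z. norm z \<le> real r \<and> norm (q z) \<le> real r}" for r :: nat
  have G[measurable]: "G r \<in> sets borel" for r
  proof -
    have "Measurable.pred borel (\<lambda>z. norm z \<le> real r \<and> norm (q z) \<le> real r)" by measurable
    then show ?thesis using fibre_exit_points_borel by (auto simp: G_def pred_def)
  qed
  have q_eq: "P y = P z \<Longrightarrow> q y = q z" for y z by (simp add: q_def fibre_def)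
  have q_fib: "q z \<in> fibre z" for z
    unfolding q_def by (rule closest_point_in_set[OF closed_fibre]) (use fibre_self[of z] in blast)
  define \<sigma> where "\<sigma> t y = (1 / (1 - t)) *\<^sub>R (y - t *\<^sub>R q y)" for t y
  define V where "V r t = {y. \<sigma> t y \<in> G r \<and> P (\<sigma> t y) = P y}" for r t
  have [measurable]: "\<sigma> t \<in> borel_measurable borel" for t
    unfolding \<sigma>_def[abs_def] by measurable
  have V: "V r t \<in> sets borel" for r t
  proof -
    have "Measurable.pred borel (\<lambda>y. \<sigma> t y \<in> G r \<and> P (\<sigma> t y) = P y)" by measurable
    then show ?thesis by (simp add: V_def pred_def)
  qed
  have y_eq: "y = (1 - t) *\<^sub>R \<sigma> t y + t *\<^sub>R q y" if "t < 1" for t y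
    using that by (simp add: \<sigma>_def)
  have V_bounded: "V r t \<subseteq> cball 0 r" if t: "0 \<le> t" "t < 1" for r t
  proof
    fix y assume y: "y \<in> V r t"
    then have "norm (\<sigma> t y) \<le> r" "norm (q y) \<le> r" 
      using q_eq[of y "\<sigma> t y"] by (auto simp: V_def G_def)
    then have "\<sigma> t y \<in> cball 0 (real r)" "q y \<in> cball 0 (real r)" by auto
    from convexD[OF convex_cball this, of "1 - t" t] show "y \<in> cball 0 r"
      using y_eq[of t y] t by simp
  qed
  have V_disjoint: "V r t \<inter> V r t' = {}" if t: "t < t'" "t' < 1" for r t t'
  proof (rule ccontr)
    assume "V r t \<inter> V r t' \<noteq> {}"
    then obtain y where y: "y \<in> V r t" "y \<in> V r t'" by auto
    define z z' where "z = \<sigma> t y" and "z' = \<sigma> t' y"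
    have P: "P z = P y" "P z' = P y" using y by (auto simp: V_def z_def z'_def)
    define s where "s = (t' - t) / (1 - t')"
    have "s > 0" using t by (simp add: s_def)
    \<comment> \<open>Both \<open>z\<close> and \<open>z'\<close> lie on the ray from \<open>q y\<close> through \<open>y\<close>, with \<open>z'\<close> farther out, so \<open>z\<close> is no exit point.\<close>
    have 1: "z - q y = (1 / (1 - t)) *\<^sub>R (y - q y)" "z' - q y = (1 / (1 - t')) *\<^sub>R (y - q y)"
    proof -
      have "\<sigma> t y - q y = (1 / (1 - t)) *\<^sub>R (y - q y)" if "t < 1" for t
      proof -
        have "(1 - t) *\<^sub>R (\<sigma> t y - q y) = y - q y"
          using y_eq[OF that, of y] by (simp add: algebra_simps)
        moreover have "(1 / (1 - t)) *\<^sub>R ((1 - t) *\<^sub>R (\<sigma> t y - q y)) = \<sigma> t y - q y"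
          using that by simp
        ultimately show ?thesis by simp
      qed
      then show "z - q y = (1 / (1 - t)) *\<^sub>R (y - q y)" "z' - q y = (1 / (1 - t')) *\<^sub>R (y - q y)"
        using t by (auto simp: z_def z'_def)
    qed
    have "(1 + s) * (1 / (1 - t)) = 1 / (1 - t')"
      using t by (simp add: s_def field_simps)
    then have "z' - q y = (1 + s) *\<^sub>R (z - q y)" by (simp add: 1)
    then have "z' = z + s *\<^sub>R (z - q z)" using q_eq[OF P(1)] by (simp add: algebra_simps)
    moreover have "z' \<in> fibre z" using P by (simp add: fibre_def)
    moreover have "z \<in> fibre_exit_points a" using y by (auto simp: V_def G_def z_def)
    ultimately show False using \<open>s > 0\<close> by (auto simp: fibre_exit_points_def q_def)
  qed
  have G_sub: "G r \<subseteq> (\<lambda>z. (1 - t) *\<^sub>R z + t *\<^sub>R closest_point (fibre z) a) -` V r t"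
    if t: "0 \<le> t" "t < 1" for r t
  proof
    fix z assume z: "z \<in> G r"
    define y where "y = (1 - t) *\<^sub>R z + t *\<^sub>R q z"
    have "y \<in> fibre z"
      unfolding y_def using convexD[OF convex_fibre fibre_self q_fib, of "1 - t" t] t by auto
    then have "P y = P z" by (simp add: fibre_def)
    moreover from this have "\<sigma> t y = z" using q_eq[of y z] t by (simp add: \<sigma>_def y_def)
    ultimately have "y \<in> V r t" using z by (simp add: V_def)
    then show "z \<in> (\<lambda>z. (1 - t) *\<^sub>R z + t *\<^sub>R closest_point (fibre z) a) -` V r t"
      by (simp add: y_def q_def)
  qed
  \<comment> \<open>Any sequence of distinct parameters bounded away from one would do.\<close>
  define t where "t j = 1 / (real j + 2)" for j :: nat
  have t: "0 \<le> t j" "t j \<le> 1/2" "t j < 1" for j by (auto simp: t_def field_simps)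
  have null: "emeasure lborel (G r) = 0" for r
  proof (rule ccontr)
    assume nz: "emeasure lborel (G r) \<noteq> 0"
    define m where "m = ennreal ((1/2) ^ DIM('a)) * emeasure lborel (G r)"
    have "m \<noteq> 0" using nz by (simp add: m_def)
    have lower: "m \<le> emeasure lborel (V r (t j))" for j
    proof -
      note contr = volume_contraction_bound_towards_closest_point[OF t(1,3), of j a, unfolded volume_contraction_bound_def]
      have "(1/2 :: real) ^ DIM('a) \<le> (1 - t j) ^ DIM('a)"
        using t[of j] by (intro power_mono) auto
      then have "m \<le> ennreal ((1 - t j) ^ DIM('a)) * emeasure lborel (G r)"
        unfolding m_def by (intro mult_right_mono ennreal_leI) auto
      also have "\<dots> \<le> ennreal ((1 - t j) ^ DIM('a)) *
          emeasure lborel ((\<lambda>z. (1 - t j) *\<^sub>R z + t j *\<^sub>R closest_point (fibre z) a) -` V r (t j))"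
        using G_sub[OF t(1,3)] contr V measurable_sets[of _ borel borel "V r (t j)"]
        by (intro mult_left_mono emeasure_mono) auto
      also have "\<dots> \<le> emeasure lborel (V r (t j))"
        using contr V by blast
      finally show ?thesis .
    qed
    have disj: "disjoint_family (\<lambda>j. V r (t j))"
    proof (unfold disjoint_family_on_def, intro ballI impI)
      fix i j :: nat assume "i \<noteq> j"
      then have "t i < t j \<or> t j < t i" by (auto simp: t_def field_simps)
      then show "V r (t i) \<inter> V r (t j) = {}" using V_disjoint t(3) by blast
    qed
    have "(\<Sum>j. m) \<le> (\<Sum>j. emeasure lborel (V r (t j)))"
      using lower by (intro suminf_le) auto
    also have "\<dots> = emeasure lborel (\<Union>j. V r (t j))"
      using V disj by (intro suminf_emeasure) auto
    also have "\<dots> \<le> emeasure lborel (cball (0::'a) r)"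
      using V_bounded[OF t(1,3)] by (intro emeasure_mono) auto
    also have "\<dots> < \<infinity>" by (rule emeasure_lborel_cball_finite)
    also have "(\<Sum>j::nat. m) = (\<Sum>j::nat. 1) * m" by (simp flip: ennreal_suminf_multc)
    also have "(\<Sum>j::nat. 1::ennreal) = \<infinity>"
    proof (rule ccontr)
      assume "(\<Sum>j::nat. 1::ennreal) \<noteq> \<infinity>"
      then have "summable (\<lambda>_::nat. 1::real)"
        using summable_suminf_not_top[of "\<lambda>_. 1"] by simp
      then show False by (simp add: summable_const_iff)
    qed
    finally show False using \<open>m \<noteq> 0\<close> by (simp add: ennreal_top_mult)
  qed
  have "fibre_exit_points a = (\<Union>r. G r)"
  proof (intro equalityI subsetI)
    fix z assume z: "z \<in> fibre_exit_points a"
    obtain r :: nat where "max (norm z) (norm (q z)) \<le> r" using real_arch_simple by blast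
    with z show "z \<in> (\<Union>r. G r)" by (auto simp: G_def)
  qed (auto simp: G_def)
  moreover have "negligible (G r)" for r
    using null[of r] by (auto simp: negligible_iff_null_sets null_sets_def)
  ultimately show ?thesis by (auto intro: negligible_Union_nat)
qed

text \<open>
  A member \<open>a\<close> of a countable dense set that is within \<open>e/2\<close> of a point \<open>b\<close> of the fibre has its closest
  point within \<open>e\<close> of \<open>b\<close>. If the fibre contains the \<open>e\<close>-ball around \<open>b\<close> in its affine
  hull, the closest point is a relative interior point, and then a ray from it cannot be prolonged within the
  fibre beyond a relative boundary point.
\<close>

theorem negligible_relative_boundaries_of_fibres:
  "negligible {z. z \<notin> rel_interior (fibre z)}"
proof -
  obtain D :: "'a set" where D: "countable D" "\<And>X. open X \<Longrightarrow> X \<noteq> {} \<Longrightarrow> \<exists>d\<in>D. d \<in> X"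
    using countable_dense_exists by metis
  have "{z. z \<notin> rel_interior (fibre z)} \<subseteq> (\<Union>a\<in>D. fibre_exit_points a)"
  proof
    fix z assume "z \<in> {z. z \<notin> rel_interior (fibre z)}"
    then have z: "z \<notin> rel_interior (fibre z)" by simp
    have "rel_interior (fibre z) \<noteq> {}"
      using rel_interior_eq_empty[OF convex_fibre, of z] fibre_self[of z] by auto
    then obtain b where "b \<in> rel_interior (fibre z)" by auto
    then obtain e where b: "b \<in> fibre z"
      and e: "e > 0" "ball b e \<inter> affine hull (fibre z) \<subseteq> fibre z"
      by (auto simp: mem_rel_interior_ball)
    obtain a where a: "a \<in> D" "a \<in> ball b (e/2)"
      using D(2)[of "ball b (e/2)"] e by auto
    define c where "c = closest_point (fibre z) a"
    have c: "c \<in> fibre z"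
      unfolding c_def by (rule closest_point_in_set[OF closed_fibre]) (use fibre_self[of z] in blast)
    have "dist a c \<le> dist a b"
      unfolding c_def by (rule closest_point_le[OF closed_fibre b])
    then have "dist b c < e"
      using a(2) dist_triangle[of b c a] by (simp add: dist_commute)
    then have "c \<in> ball b e" by simp
    then have c_ri: "c \<in> rel_interior (fibre z)"
      using c e(2) unfolding mem_rel_interior by (intro exI[of _ "ball b e"]) simp
    have "c \<noteq> z" using z c_ri by auto
    moreover have "z + s *\<^sub>R (z - c) \<notin> fibre z" if s: "s > 0" for s
    proof
      assume y: "z + s *\<^sub>R (z - c) \<in> fibre z"
      have "z + s *\<^sub>R (z - c) - (s / (1 + s)) *\<^sub>R (z + s *\<^sub>R (z - c) - c) \<in> rel_interior (fibre z)"
        using s y by (intro rel_interior_convex_shrink[OF convex_fibre c_ri]) auto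
      also have "z + s *\<^sub>R (z - c) - c = (1 + s) *\<^sub>R (z - c)" by (simp add: algebra_simps)
      also have "(s / (1 + s)) *\<^sub>R \<dots> = s *\<^sub>R (z - c)" using s by simp
      finally show False using z by simp
    qed
    ultimately have "z \<in> fibre_exit_points a"
      by (simp add: fibre_exit_points_def c_def)
    then show "z \<in> (\<Union>a\<in>D. fibre_exit_points a)" using a by auto
  qed
  moreover have "negligible (\<Union>a\<in>D. fibre_exit_points a)"
  proof -
    have "(\<Union>a\<in>D. fibre_exit_points a) \<in> null_sets lebesgue"
      using D(1) negligible_fibre_exit_points
      by (intro null_sets_UN') (auto simp: negligible_iff_null_sets)
    then show ?thesis by (simp add: negligible_iff_null_sets)
  qed
  ultimately show ?thesis by (rule negligible_subset[rotated])
qed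

end

section \<open>Proximal maps of convex functions on compact sets\<close>

definition subgradients_on :: "'a::euclidean_space set \<Rightarrow> ('a \<Rightarrow> real) \<Rightarrow> 'a \<Rightarrow> 'a set" where
  "subgradients_on B h p = {w. p \<in> B \<and> (\<forall>x\<in>B. h p + w \<bullet> (x - p) \<le> h x)}"

text \<open>
  The first-order optimality condition along a segment, isolated from its use: dividing by \<open>t\<close> and letting
  \<open>t\<close> tend to zero removes the quadratic term.
\<close>

lemma linear_le_quadratic_imp_nonpos:
  fixes a K :: real
  assumes "\<And>t. 0 < t \<Longrightarrow> t \<le> 1 \<Longrightarrow> t * a \<le> t\<^sup>2 * K"
  shows "a \<le> 0"
proof (rule field_le_epsilon)
  fix e :: real assume e: "0 < e"
  define t where "t = min 1 (e / (\<bar>K\<bar> + 1))"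
  have t: "0 < t" "t \<le> 1" "t \<le> e / (\<bar>K\<bar> + 1)" using e by (auto simp: t_def)
  have "t * a \<le> t * (t * K)" using assms[OF t(1,2)] by (simp add: power2_eq_square mult.assoc)
  then have "a \<le> t * K" using t(1) by simp
  also have "\<dots> \<le> t * (\<bar>K\<bar> + 1)" using t(1) by (intro mult_left_mono) auto
  also have "\<dots> \<le> e" using t(3) by (simp add: pos_le_divide_eq)
  finally show "a \<le> 0 + e" by simp
qed

text \<open>
  The point is a maximizer of \<open>z \<bullet> x - h x - |x|\<^sup>2/2\<close> over \<open>B\<close>, which exists by compactness; comparing it with the
  points of a segment that starts there yields the subgradient inequality.
\<close>

lemma proximal_point_exists:
  assumes "compact B" "B \<noteq> {}" "convex_on B h" "continuous_on B h"
  shows "\<exists>p. z - p \<in> subgradients_on B h p"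
proof -
  have "continuous_on B (\<lambda>x. z \<bullet> x - h x - (norm x)\<^sup>2 / 2)"
    by (intro continuous_intros assms) simp
  then obtain p where p: "p \<in> B"
    and max: "\<And>x. x \<in> B \<Longrightarrow> z \<bullet> x - h x - (norm x)\<^sup>2 / 2 \<le> z \<bullet> p - h p - (norm p)\<^sup>2 / 2"
    using continuous_attains_sup[OF assms(1,2), of "\<lambda>x. z \<bullet> x - h x - (norm x)\<^sup>2 / 2"] by metis
  have "h p + (z - p) \<bullet> (x - p) \<le> h x" if x: "x \<in> B" for x
  proof -
    have "(z - p) \<bullet> (x - p) - (h x - h p) \<le> 0"
    proof (rule linear_le_quadratic_imp_nonpos)
      fix t :: real assume t: "0 < t" "t \<le> 1"
      define y where "y = (1 - t) *\<^sub>R p + t *\<^sub>R x"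
      have "y \<in> B"
        unfolding y_def using convexD[OF convex_on_imp_convex[OF assms(3)] p x] t by auto
      have "h y \<le> (1 - t) * h p + t * h x"
        unfolding y_def using convex_onD[OF assms(3), of t p x] p x t by auto
      moreover have "z \<bullet> y - h y - (norm y)\<^sup>2 / 2 \<le> z \<bullet> p - h p - (norm p)\<^sup>2 / 2"
        by (rule max[OF \<open>y \<in> B\<close>])
      moreover have y: "y = p + t *\<^sub>R (x - p)" by (simp add: y_def algebra_simps)
      have "(norm y)\<^sup>2 = (norm p)\<^sup>2 + 2 * (t * (p \<bullet> (x - p))) + t\<^sup>2 * (norm (x - p))\<^sup>2"
        unfolding y power2_norm_eq_inner
        by (simp add: inner_add_left inner_add_right inner_commute power2_eq_square algebra_simps)
      moreover have "z \<bullet> y = z \<bullet> p + t * (z \<bullet> (x - p))"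
        by (simp add: y inner_add_right)
      moreover have "t * ((z - p) \<bullet> (x - p) - (h x - h p))
          = t * (z \<bullet> (x - p)) - t * (p \<bullet> (x - p)) - t * h x + t * h p"
        by (simp add: inner_diff_left[of z p] right_diff_distrib)
      moreover have "(1 - t) * h p = h p - t * h p" by (simp add: left_diff_distrib)
      ultimately show "t * ((z - p) \<bullet> (x - p) - (h x - h p)) \<le> t\<^sup>2 * ((norm (x - p))\<^sup>2 / 2)"
        unfolding times_divide_eq_right by linarith
    qed
    then show ?thesis by simp
  qed
  with p show ?thesis by (auto simp: subgradients_on_def)
qed

lemma proximal_points_monotone:
  assumes "y - p \<in> subgradients_on B h p" "z - q \<in> subgradients_on B h q"
  shows "(norm (p - q))\<^sup>2 \<le> (y - z) \<bullet> (p - q)"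
proof -
  have "h p + (y - p) \<bullet> (q - p) \<le> h q" "h q + (z - q) \<bullet> (p - q) \<le> h p"
    using assms by (auto simp: subgradients_on_def)
  then have "(y - p) \<bullet> (q - p) + (z - q) \<bullet> (p - q) \<le> 0" by linarith
  also have "(y - p) \<bullet> (q - p) + (z - q) \<bullet> (p - q) = (norm (p - q))\<^sup>2 - (y - z) \<bullet> (p - q)"
    unfolding power2_norm_eq_inner
    by (simp add: inner_diff_left inner_diff_right inner_commute algebra_simps)
  finally show ?thesis by simp
qed

text \<open>
  The potential is the conjugate of \<open>h + |.|\<^sup>2/2\<close> restricted to \<open>B\<close>; the quadratic term makes
  the maximizer, and hence the gradient \<open>P\<close> of the conjugate, single valued. The fibres of \<open>P\<close> are
  thus the subdifferentials of \<open>h\<close>, translated by their base points.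
\<close>

lemma proximal_map:
  assumes "compact B" "B \<noteq> {}" "convex_on B h" "continuous_on B h"
  obtains P \<phi> where "convex_gradient P \<phi>"
    and "\<And>z p. P z = p \<longleftrightarrow> z - p \<in> subgradients_on B h p"
proof -
  obtain P where P: "\<And>z. z - P z \<in> subgradients_on B h (P z)"
    using proximal_point_exists[OF assms] by metis
  have char: "P z = p \<longleftrightarrow> z - p \<in> subgradients_on B h p" for z p
  proof
    assume "z - p \<in> subgradients_on B h p"
    from proximal_points_monotone[OF P[of z] this] show "P z = p" by simp
  qed (use P in auto)
  define \<phi> where "\<phi> z = z \<bullet> P z - h (P z) - (norm (P z))\<^sup>2 / 2" for z
  have "convex_gradient P \<phi>"
  proof
    show "(norm (P y - P z))\<^sup>2 \<le> (y - z) \<bullet> (P y - P z)" for y z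
      by (rule proximal_points_monotone[OF P P])
    show "\<phi> z + P z \<bullet> (y - z) \<le> \<phi> y" for z y
    proof -
      have "h (P y) + (y - P y) \<bullet> (P z - P y) \<le> h (P z)"
        using P[of y] P[of z] by (auto simp: subgradients_on_def)
      moreover have "0 \<le> (norm (P y - P z))\<^sup>2" by simp
      ultimately show ?thesis
        unfolding \<phi>_def power2_norm_eq_inner
        by (simp add: inner_diff_left inner_diff_right inner_commute algebra_simps)
    qed
  qed
  then show ?thesis using char by (rule that)
qed

section \<open>Limiting subdifferentials of functions that are convex up to a quadratic\<close>

lemma regular_normal_coneI_quadratic:
  assumes "x \<in> S" and "\<forall>\<^sub>F y in at x within S. v \<bullet> (y - x) \<le> \<rho> * (norm (y - x))\<^sup>2"
  shows "v \<in> regular_normal_cone S x"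
proof -
  \<comment> \<open>The bound has to hold on all of \<open>S\<close>, the quadratic estimate only near \<open>x\<close>; hence the positive part itself as error term.\<close>
  define \<omega> where "\<omega> y = max 0 (v \<bullet> (y - x))" for y
  have "((\<lambda>y. \<omega> y / norm (y - x)) \<longlongrightarrow> 0) (at x within S)"
  proof (rule tendsto_sandwich)
    show "\<forall>\<^sub>F y in at x within S. 0 \<le> \<omega> y / norm (y - x)"
      by (simp add: \<omega>_def)
    show "\<forall>\<^sub>F y in at x within S. \<omega> y / norm (y - x) \<le> \<bar>\<rho>\<bar> * norm (y - x)"
      using assms(2)
    proof eventually_elim
      case (elim y)
      have "\<rho> * (norm (y - x))\<^sup>2 \<le> \<bar>\<rho>\<bar> * (norm (y - x))\<^sup>2" by (intro mult_right_mono) auto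
      with elim have "\<omega> y \<le> \<bar>\<rho>\<bar> * norm (y - x) * norm (y - x)"
        by (simp add: \<omega>_def power2_eq_square mult.assoc)
      then show ?case by (cases "y = x") (auto simp: pos_divide_le_eq)
    qed
    show "((\<lambda>y. \<bar>\<rho>\<bar> * norm (y - x)) \<longlongrightarrow> 0) (at x within S)"
      by (auto intro!: tendsto_eq_intros)
  qed auto
  moreover have "\<forall>y\<in>S. v \<bullet> (y - x) \<le> \<omega> y" by (simp add: \<omega>_def)
  ultimately show ?thesis using assms(1) by (auto simp: regular_normal_cone_def)
qed

lemma regular_normal_feasible_direction:
  assumes v: "v \<in> regular_normal_cone S x"
    and feasible: "\<And>t. 0 < t \<Longrightarrow> t \<le> 1 \<Longrightarrow> x + t *\<^sub>R d \<in> S"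
  shows "v \<bullet> d \<le> 0"
proof (cases "d = 0")
  case False
  obtain \<omega> where \<omega>: "\<And>y. y \<in> S \<Longrightarrow> v \<bullet> (y - x) \<le> \<omega> y"
    "((\<lambda>y. \<omega> y / norm (y - x)) \<longlongrightarrow> 0) (at x within S)"
    using v by (auto simp: regular_normal_cone_def)
  define t where "t n = 1 / real (Suc n)" for n
  have t: "0 < t n" "t n \<le> 1" for n by (auto simp: t_def)
  have t0: "t \<longlonglongrightarrow> 0"
    unfolding t_def by (rule lim_1_over_real_power[of 1, simplified, THEN LIMSEQ_Suc])
  have "filterlim (\<lambda>n. x + t n *\<^sub>R d) (at x within S) sequentially"
    unfolding filterlim_at using feasible[OF t] t(1) False
    by (auto intro!: tendsto_eq_intros t0 simp: less_imp_neq[THEN not_sym] always_eventually)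
  from filterlim_compose[OF \<omega>(2) this]
  have "(\<lambda>n. \<omega> (x + t n *\<^sub>R d) / (t n * norm d) * norm d) \<longlonglongrightarrow> 0 * norm d"
    using t(1) by (intro tendsto_intros) (simp add: less_imp_le)
  then have "(\<lambda>n. \<omega> (x + t n *\<^sub>R d) / t n) \<longlonglongrightarrow> 0" using False by simp
  moreover have "v \<bullet> d \<le> \<omega> (x + t n *\<^sub>R d) / t n" for n
    using \<omega>(1)[OF feasible[OF t]] t(1)[of n] by (simp add: pos_le_divide_eq mult.commute)
  ultimately show ?thesis by (intro tendsto_lowerbound[where F = sequentially]) auto
qed simp

lemma mem_epi_extend_by_infinity:
  "(y, r) \<in> epi (extend_by_infinity U f) \<longleftrightarrow> y \<in> U \<and> f y \<le> r"
  by (simp add: epi_def extend_by_infinity_def)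

lemma limiting_subdifferential_extend_by_infinity:
  "limiting_subdifferential (extend_by_infinity U f) x =
    (if x \<in> U then {w. (w, - 1) \<in> limiting_normal_cone (epi (extend_by_infinity U f)) (x, f x)} else {})"
  by (simp add: limiting_subdifferential_def extend_by_infinity_def)

text \<open>
  A subgradient of \<open>h \<rho>\<close> supports \<open>f\<close> up to a quadratic error and so gives a regular normal of the
  epigraph. Conversely, convexity makes the epigraph, seen from any of its points over \<open>B\<close>, contain
  the segment in the direction \<open>(y - x, M)\<close>, where \<open>M\<close> is the increment of \<open>h \<rho>\<close> minus the
  derivative of the quadratic. Regular normals have nonpositive product with this direction, and the
  resulting inequality survives the limit. Nonnegativity of \<open>\<rho>\<close> allows the term quadratic in the step to be dropped.
\<close>

lemma limiting_subdifferential_convex_up_to_quadratic: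
  fixes f :: "'a::euclidean_space \<Rightarrow> real"
  defines "h \<equiv> \<lambda>\<rho> x. f x + \<rho> * (norm x)\<^sup>2"
  assumes BU: "B \<subseteq> U" and \<rho>: "0 \<le> \<rho>" and conv: "convex_on B (h \<rho>)"
    and cont: "continuous_on B (h \<rho>)" and x: "x \<in> interior B"
  shows "limiting_subdifferential (extend_by_infinity U f) x =
           {w. w + (2 * \<rho>) *\<^sub>R x \<in> subgradients_on B (h \<rho>) x}"
proof -
  define E where "E = epi (extend_by_infinity U f)"
  have xB: "x \<in> B" using x interior_subset by blast
  have norm_expand: "(norm y)\<^sup>2 = (norm x)\<^sup>2 + 2 * (x \<bullet> (y - x)) + (norm (y - x))\<^sup>2" for x y :: 'a
    unfolding power2_norm_eq_inner by (simp add: inner_diff_left inner_diff_right inner_commute)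
  have "(w, - 1) \<in> limiting_normal_cone E (x, f x) \<longleftrightarrow>
      w + (2 * \<rho>) *\<^sub>R x \<in> subgradients_on B (h \<rho>) x" for w
  proof
    assume sub: "w + (2 * \<rho>) *\<^sub>R x \<in> subgradients_on B (h \<rho>) x"
    have xE: "(x, f x) \<in> E" using xB BU by (auto simp: E_def mem_epi_extend_by_infinity)
    have "(w, - 1) \<in> regular_normal_cone E (x, f x)"
    proof (rule regular_normal_coneI_quadratic[OF xE])
      have "\<forall>\<^sub>F p in at (x, f x) within E. fst p \<in> interior B"
      proof (rule topological_tendstoD[OF _ open_interior])
        show "(fst \<longlongrightarrow> x) (at (x, f x) within E)"
          using tendsto_fst[OF tendsto_ident_at[of "(x, f x)" E]] by simp
      qed (rule x)
      moreover have "\<forall>\<^sub>F p in at (x, f x) within E. p \<in> E"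
        by (simp add: eventually_at_filter)
      ultimately show "\<forall>\<^sub>F p in at (x, f x) within E.
          (w, - 1) \<bullet> (p - (x, f x)) \<le> \<rho> * (norm (p - (x, f x)))\<^sup>2"
      proof eventually_elim
        case (elim p)
        obtain y r where p: "p = (y, r)" by (cases p)
        have y: "y \<in> B" "f y \<le> r"
          using elim interior_subset by (auto simp: p E_def mem_epi_extend_by_infinity)
        then have "h \<rho> x + (w + (2 * \<rho>) *\<^sub>R x) \<bullet> (y - x) \<le> h \<rho> y"
          using sub by (auto simp: subgradients_on_def)
        then have "w \<bullet> (y - x) - (f y - f x) \<le> \<rho> * (norm (y - x))\<^sup>2"
          unfolding h_def norm_expand[of y x] by (simp add: inner_add_left algebra_simps)
        also have "\<dots> \<le> \<rho> * (norm (p - (x, f x)))\<^sup>2"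
          using \<rho> norm_fst_le[of "y - x" "r - f x"] by (intro mult_left_mono power_mono) (auto simp: p)
        finally show ?case using y(2) by (simp add: p)
      qed
    qed
    then show "(w, - 1) \<in> limiting_normal_cone E (x, f x)"
      using xE unfolding limiting_normal_cone_def by (auto intro!: exI[of _ "\<lambda>_. _"])
  next
    assume "(w, - 1) \<in> limiting_normal_cone E (x, f x)"
    then obtain X W where X: "\<And>r. X r \<in> E" and W: "\<And>r. W r \<in> regular_normal_cone E (X r)"
      and limX: "X \<longlonglongrightarrow> (x, f x)" and limW: "W \<longlonglongrightarrow> (w, - 1)"
      by (auto simp: limiting_normal_cone_def)
    define a where "a r = fst (X r)" for r
    have lima: "a \<longlonglongrightarrow> x" using tendsto_fst[OF limX] by (simp add: a_def[abs_def])
    have limw: "(\<lambda>r. fst (W r)) \<longlonglongrightarrow> w" "(\<lambda>r. snd (W r)) \<longlonglongrightarrow> - 1"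
      using tendsto_fst[OF limW] tendsto_snd[OF limW] by auto
    have aB: "\<forall>\<^sub>F r in sequentially. a r \<in> interior B"
      using topological_tendstoD[OF lima open_interior x] .
    have limh: "(\<lambda>r. h \<rho> (a r)) \<longlonglongrightarrow> h \<rho> x"
      by (rule continuous_on_tendsto_compose[OF cont lima xB])
         (use aB interior_subset in \<open>auto elim!: eventually_mono\<close>)
    have "h \<rho> x + (w + (2 * \<rho>) *\<^sub>R x) \<bullet> (y - x) \<le> h \<rho> y" if y: "y \<in> B" for y
    proof -
      define M where "M r = h \<rho> y - h \<rho> (a r) - 2 * \<rho> * (a r \<bullet> (y - a r))" for r
      have "\<forall>\<^sub>F r in sequentially. fst (W r) \<bullet> (y - a r) + snd (W r) * M r \<le> 0"
        using aB
      proof eventually_elim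
        case (elim r)
        then have ar: "a r \<in> B" using interior_subset by blast
        have "W r \<bullet> (y - a r, M r) \<le> 0"
        proof (rule regular_normal_feasible_direction[OF W])
          fix t :: real assume t: "0 < t" "t \<le> 1"
          define c where "c = a r + t *\<^sub>R (y - a r)"
          have c: "c = (1 - t) *\<^sub>R a r + t *\<^sub>R y" by (simp add: c_def algebra_simps)
          have cB: "c \<in> B"
            unfolding c using convexD[OF convex_on_imp_convex[OF conv] ar y] t by auto
          have hc: "h \<rho> c \<le> (1 - t) * h \<rho> (a r) + t * h \<rho> y"
            unfolding c using convex_onD[OF conv, of t "a r" y] ar y t by auto
          have "(norm c)\<^sup>2 = (norm (a r))\<^sup>2 + 2 * (a r \<bullet> (c - a r)) + (norm (c - a r))\<^sup>2"
            by (rule norm_expand)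
          also have "\<dots> \<ge> (norm (a r))\<^sup>2 + 2 * (t * (a r \<bullet> (y - a r)))" by (simp add: c_def)
          finally have "\<rho> * ((norm (a r))\<^sup>2 + 2 * (t * (a r \<bullet> (y - a r)))) \<le> \<rho> * (norm c)\<^sup>2"
            using \<rho> by (rule mult_left_mono)
          with hc have "f c \<le> f (a r) + t * M r"
            by (simp add: h_def M_def algebra_simps)
          moreover have "f (a r) \<le> snd (X r)"
            using X[of r] by (cases "X r") (simp add: a_def E_def mem_epi_extend_by_infinity)
          ultimately have "(c, snd (X r) + t * M r) \<in> E"
            using cB BU by (auto simp: E_def mem_epi_extend_by_infinity)
          moreover have "X r + t *\<^sub>R (y - a r, M r) = (c, snd (X r) + t * M r)"
            by (cases "X r") (simp add: c_def a_def)
          ultimately show "X r + t *\<^sub>R (y - a r, M r) \<in> E" by simp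
        qed
        then show ?case by (cases "W r") simp
      qed
      moreover have "(\<lambda>r. fst (W r) \<bullet> (y - a r) + snd (W r) * M r) \<longlonglongrightarrow>
          w \<bullet> (y - x) + (- 1) * (h \<rho> y - h \<rho> x - 2 * \<rho> * (x \<bullet> (y - x)))"
        unfolding M_def by (intro tendsto_intros limw lima limh)
      ultimately have "w \<bullet> (y - x) + (- 1) * (h \<rho> y - h \<rho> x - 2 * \<rho> * (x \<bullet> (y - x))) \<le> 0"
        by (intro tendsto_upperbound) auto
      then show ?thesis by (simp add: inner_add_left)
    qed
    with xB show "w + (2 * \<rho>) *\<^sub>R x \<in> subgradients_on B (h \<rho>) x"
      by (auto simp: subgradients_on_def)
  qed
  then show ?thesis
    using xB BU by (auto simp: limiting_subdifferential_extend_by_infinity E_def)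
qed

section \<open>Generic nondegeneracy of critical points\<close>

lemma convex_on_norm_squared:
  assumes "convex B"
  shows "convex_on B (\<lambda>x::'a::real_inner. (norm x)\<^sup>2)"
proof (rule convex_onI)
  fix t :: real and x y :: 'a assume t: "0 < t" "t < 1"
  have "(1 - t) * (norm x)\<^sup>2 + t * (norm y)\<^sup>2 - (norm ((1 - t) *\<^sub>R x + t *\<^sub>R y))\<^sup>2
      = t * (1 - t) * (norm (x - y))\<^sup>2"
    unfolding power2_norm_eq_inner
    by (simp add: inner_add_left inner_add_right inner_diff_left inner_diff_right inner_commute algebra_simps)
  also have "\<dots> \<ge> 0" using t by simp
  finally show "(norm ((1 - t) *\<^sub>R x + t *\<^sub>R y))\<^sup>2 \<le> (1 - t) * (norm x)\<^sup>2 + t * (norm y)\<^sup>2"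
    by simp
qed (rule assms)

lemma convex_on_subtract_linear:
  assumes "convex_on B h"
  shows "convex_on B (\<lambda>x::'a::real_inner. h x - v \<bullet> x)"
  using assms by (auto simp: convex_on_def inner_add_right algebra_simps)

text \<open>
  Adding a nonnegative multiple of \<open>|.|\<^sup>2\<close> preserves convexity, so \<open>\<rho>\<close> may be replaced by its absolute value.
\<close>

lemma lower_C2_onE:
  assumes "lower_C2_on U f" "x \<in> U"
  obtains e \<rho> where "0 < e" "0 \<le> \<rho>" "cball x e \<subseteq> U"
    "convex_on (cball x e) (\<lambda>x. f x + \<rho> * (norm x)\<^sup>2)"
    "continuous_on (cball x e) (\<lambda>x. f x + \<rho> * (norm x)\<^sup>2)"
proof -
  obtain N \<rho>' where N: "open N" "x \<in> N" "N \<subseteq> U"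
    and conv: "convex_on N (\<lambda>x. f x + \<rho>' * (norm x)\<^sup>2)"
    using assms unfolding lower_C2_on_def by blast
  obtain e where e: "0 < e" "cball x e \<subseteq> N"
    using N(1,2) open_contains_cball by blast
  have "convex_on N (\<lambda>x. (f x + \<rho>' * (norm x)\<^sup>2) + (\<bar>\<rho>'\<bar> - \<rho>') * (norm x)\<^sup>2)"
    using convex_on_imp_convex[OF conv]
    by (intro convex_on_add conv convex_on_cmul convex_on_norm_squared) auto
  then have N': "convex_on N (\<lambda>x. f x + \<bar>\<rho>'\<bar> * (norm x)\<^sup>2)"
    by (simp add: algebra_simps)
  show ?thesis
  proof (rule that)
    show "convex_on (cball x e) (\<lambda>x. f x + \<bar>\<rho>'\<bar> * (norm x)\<^sup>2)"
      by (rule convex_on_subset[OF N' e(2) convex_cball])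
    show "continuous_on (cball x e) (\<lambda>x. f x + \<bar>\<rho>'\<bar> * (norm x)\<^sup>2)"
      by (rule continuous_on_subset[OF convex_on_continuous[OF N(1) N'] e(2)])
  qed (use e N in auto)
qed

text \<open>
  The change of variables \<open>z = v + 2\<rho>x + x\<close> turns criticality into \<open>P z = x\<close>; it translates the subdifferential of the
  tilted function into the fibre through \<open>z\<close>, sending the origin to \<open>z\<close>. Degenerate tilts are thus the image of
  relative boundary points under a Lipschitz map, which preserves null sets.
\<close>

lemma negligible_degenerate_tilts_local:
  fixes f :: "'a::euclidean_space \<Rightarrow> real" and U :: "'a set"
  defines "F \<equiv> \<lambda>v. extend_by_infinity U (\<lambda>y. f y - v \<bullet> y)"
  assumes B: "compact B" and BU: "B \<subseteq> U" and \<rho>: "0 \<le> \<rho>"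
    and conv: "convex_on B (\<lambda>x. f x + \<rho> * (norm x)\<^sup>2)"
    and cont: "continuous_on B (\<lambda>x. f x + \<rho> * (norm x)\<^sup>2)"
  shows "negligible {v. \<exists>x\<in>interior B. critical_point (F v) x \<and>
                          \<not> nondegenerate_critical_point (F v) x}"
proof (cases "B = {}")
  case False
  define h where "h x = f x + \<rho> * (norm x)\<^sup>2" for x
  have "convex_on B h" "continuous_on B h" using conv cont by (auto simp: h_def[abs_def])
  then obtain P \<phi> where "convex_gradient P \<phi>"
    and P: "\<And>z p. P z = p \<longleftrightarrow> z - p \<in> subgradients_on B h p"
    using proximal_map[OF B False] by metis
  then interpret convex_gradient P \<phi> by simp
  have subdiff: "limiting_subdifferential (F v) x =
      {w. w + v + (2 * \<rho>) *\<^sub>R x \<in> subgradients_on B h x}" if "x \<in> interior B" for v x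
  proof -
    have eq: "(\<lambda>x. f x - v \<bullet> x + \<rho> * (norm x)\<^sup>2) = (\<lambda>x. h x - v \<bullet> x)"
      by (auto simp: h_def)
    have "limiting_subdifferential (F v) x =
      {w. w + (2 * \<rho>) *\<^sub>R x \<in> subgradients_on B (\<lambda>x. f x - v \<bullet> x + \<rho> * (norm x)\<^sup>2) x}"
      unfolding F_def using BU \<rho> _ _ that
    proof (rule limiting_subdifferential_convex_up_to_quadratic)
      show "convex_on B (\<lambda>x. f x - v \<bullet> x + \<rho> * (norm x)\<^sup>2)"
        unfolding eq by (rule convex_on_subtract_linear[OF \<open>convex_on B h\<close>])
      show "continuous_on B (\<lambda>x. f x - v \<bullet> x + \<rho> * (norm x)\<^sup>2)"
        unfolding eq by (intro continuous_intros \<open>continuous_on B h\<close>)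
    qed
    then show ?thesis
      unfolding eq by (auto simp: subgradients_on_def inner_add_left inner_diff_right algebra_simps)
  qed
  have "{v. \<exists>x\<in>interior B. critical_point (F v) x \<and> \<not> nondegenerate_critical_point (F v) x}
      \<subseteq> (\<lambda>z. z - (2 * \<rho> + 1) *\<^sub>R P z) ` {z. z \<notin> rel_interior (fibre z)}"
  proof
    fix v assume "v \<in> {v. \<exists>x\<in>interior B. critical_point (F v) x \<and> \<not> nondegenerate_critical_point (F v) x}"
    then obtain x where x: "x \<in> interior B" and crit: "0 \<in> limiting_subdifferential (F v) x"
      and degen: "0 \<notin> rel_interior (limiting_subdifferential (F v) x)"
      by (auto simp: critical_point_def nondegenerate_critical_point_def)
    define z where "z = v + (2 * \<rho>) *\<^sub>R x + x"
    have z: "P z = x"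
      using crit unfolding P subdiff[OF x] by (simp add: z_def)
    have "limiting_subdifferential (F v) x = (\<lambda>y. - z + y) ` fibre z"
    proof (intro equalityI subsetI)
      fix w assume "w \<in> limiting_subdifferential (F v) x"
      then have "P (z + w) = x" unfolding P subdiff[OF x] by (simp add: z_def algebra_simps)
      then show "w \<in> (\<lambda>y. - z + y) ` fibre z"
        by (intro image_eqI[of _ _ "z + w"]) (auto simp: fibre_def z)
    next
      fix w assume "w \<in> (\<lambda>y. - z + y) ` fibre z"
      then obtain y where y: "w = - z + y" "P y = x" by (auto simp: fibre_def z)
      then have "w + v + (2 * \<rho>) *\<^sub>R x = y - x" by (simp add: z_def)
      with y(2) show "w \<in> limiting_subdifferential (F v) x"
        unfolding subdiff[OF x] P by simp
    qed
    then have "rel_interior (limiting_subdifferential (F v) x) = (\<lambda>y. - z + y) ` rel_interior (fibre z)"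
      by (simp only: rel_interior_translation)
    with degen have "z \<notin> rel_interior (fibre z)" by force
    moreover have "v = z - (2 * \<rho> + 1) *\<^sub>R P z" unfolding z by (simp add: z_def algebra_simps)
    ultimately show "v \<in> (\<lambda>z. z - (2 * \<rho> + 1) *\<^sub>R P z) ` {z. z \<notin> rel_interior (fibre z)}" by blast
  qed
  moreover have "negligible ((\<lambda>z. z - (2 * \<rho> + 1) *\<^sub>R P z) ` {z. z \<notin> rel_interior (fibre z)})"
  proof (rule negligible_locally_Lipschitz_image[OF order_refl negligible_relative_boundaries_of_fibres])
    fix z
    have "norm ((y - (2 * \<rho> + 1) *\<^sub>R P y) - (z - (2 * \<rho> + 1) *\<^sub>R P z)) \<le> (2 * \<rho> + 2) * norm (y - z)" for y
    proof -
      have "(y - (2 * \<rho> + 1) *\<^sub>R P y) - (z - (2 * \<rho> + 1) *\<^sub>R P z) = (y - z) - (2 * \<rho> + 1) *\<^sub>R (P y - P z)"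
        by (simp add: algebra_simps)
      also have "norm \<dots> \<le> norm (y - z) + norm ((2 * \<rho> + 1) *\<^sub>R (P y - P z))"
        by (rule norm_triangle_ineq4)
      also have "\<dots> = norm (y - z) + (2 * \<rho> + 1) * norm (P y - P z)" using \<rho> by simp
      also have "\<dots> \<le> norm (y - z) + (2 * \<rho> + 1) * norm (y - z)"
        using \<rho> by (intro add_left_mono mult_left_mono nonexpansive) auto
      finally show ?thesis by (simp add: algebra_simps)
    qed
    then show "\<exists>T C. open T \<and> z \<in> T \<and> (\<forall>y\<in>{z. z \<notin> rel_interior (fibre z)} \<inter> T.
        norm ((y - (2 * \<rho> + 1) *\<^sub>R P y) - (z - (2 * \<rho> + 1) *\<^sub>R P z)) \<le> C * norm (y - z))"
      by (intro exI[of _ UNIV] exI[of _ "2 * \<rho> + 2"]) auto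
  qed
  ultimately show ?thesis by (rule negligible_subset[rotated])
qed simp

theorem corollary3p10:
  fixes U :: "(real ^ 'n) set" and f :: "real ^ 'n \<Rightarrow> real"
  assumes "open U" and "lower_C2_on U f"
  shows "AE v in lebesgue. \<forall>x.
           critical_point (extend_by_infinity U (\<lambda>y. f y - v \<bullet> y)) x \<longrightarrow>
           nondegenerate_critical_point (extend_by_infinity U (\<lambda>y. f y - v \<bullet> y)) x"
proof -
  let ?F = "\<lambda>v. extend_by_infinity U (\<lambda>y. f y - v \<bullet> y)"
  define bad where "bad W = {v. \<exists>x\<in>W. critical_point (?F v) x \<and> \<not> nondegenerate_critical_point (?F v) x}" for W
  have "\<exists>e>0. negligible (bad (ball x e))" if x: "x \<in> U" for x
  proof -
    obtain e \<rho> where e: "0 < e" "0 \<le> \<rho>" "cball x e \<subseteq> U"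
      "convex_on (cball x e) (\<lambda>x. f x + \<rho> * (norm x)\<^sup>2)"
      "continuous_on (cball x e) (\<lambda>x. f x + \<rho> * (norm x)\<^sup>2)"
      using lower_C2_onE[OF assms(2) x] .
    have "negligible (bad (ball x e))"
      using negligible_degenerate_tilts_local[OF compact_cball e(3,2,4,5)]
      by (simp add: bad_def)
    with e(1) show ?thesis by blast
  qed
  then obtain e where e: "\<And>x. x \<in> U \<Longrightarrow> 0 < e x" "\<And>x. x \<in> U \<Longrightarrow> negligible (bad (ball x (e x)))"
    by metis
  obtain \<C> where \<C>: "\<C> \<subseteq> (\<lambda>x. ball x (e x)) ` U" "countable \<C>" "\<Union>\<C> = (\<Union>x\<in>U. ball x (e x))"
    using Lindelof[of "(\<lambda>x. ball x (e x)) ` U"] by auto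
  have "(\<Union>W\<in>\<C>. bad W) \<in> null_sets lebesgue"
    using \<C>(1,2) e(2) by (intro null_sets_UN') (auto simp: negligible_iff_null_sets)
  then show ?thesis
  proof (rule AE_I')
    show "{v \<in> space lebesgue. \<not> (\<forall>x. critical_point (?F v) x \<longrightarrow> nondegenerate_critical_point (?F v) x)}
        \<subseteq> (\<Union>W\<in>\<C>. bad W)"
    proof
      fix v assume "v \<in> {v \<in> space lebesgue. \<not> (\<forall>x. critical_point (?F v) x \<longrightarrow> nondegenerate_critical_point (?F v) x)}"
      then obtain x where x: "critical_point (?F v) x" "\<not> nondegenerate_critical_point (?F v) x" by auto
      then have "x \<in> U"
        by (auto simp: critical_point_def limiting_subdifferential_extend_by_infinity split: if_splits)
      then have "x \<in> \<Union>\<C>" unfolding \<C>(3) using e(1)[OF \<open>x \<in> U\<close>] by (auto intro!: bexI[of _ x])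
      with x show "v \<in> (\<Union>W\<in>\<C>. bad W)" by (auto simp: bad_def)
    qed
  qed
qed

end
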